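(* Let $\mathcal{L} = \{ x \in \Omega : f(x) \le f(x_1)\}$, where $x_1=\mathcal{P}_\Omega(x_0)$ is the feasible starting iterate of PASA. Assume: (A1) $f$ is bounded from below on $\mathcal{L}$ and $d_{\max} = \sup_k \|d_k\| < \infty$, where $d_k=d^\alpha(x_k)$ are the search directions used in the GPA iterations; (A2) if $\bar{\mathcal{L}}$ is the collection of $x \in \Omega$ whose distance to $\mathcal{L}$ is at most $d_{\max}$, then $\nabla f$ is Lipschitz continuous on $\bar{\mathcal{L}}$. Assume also that the linearly constrained optimizer LCO used in phase two satisfies (F1), (F2) and (F3). Then PASA with $\epsilon = 0$ either terminates in a finite number of iterations at a stationary point of the problem $\min\{f(x): x\in\Omega\}$, or $\liminf_{k\to\infty} E(x_k) = 0$.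
   Context: Problem: $\min\{f(x): x\in\Omega\}$, $\Omega=\{x\in\mathbb{R}^n: Ax\le b\}$, where $f:\mathbb{R}^n\to\mathbb{R}$ is continuously differentiable, $A\in\mathbb{R}^{m\times n}$, $b\in\mathbb{R}^m$, and $\Omega\neq\emptyset$. A stationary point is $x^*\in\Omega$ with $\nabla f(x^* )(x-x^* )\ge 0$ for all $x\in\Omega$. Notation: $\|\cdot\|$ is the Euclidean norm; $\nabla f(x)$ is a row vector and $g(x)=\nabla f(x)^{T}$; $\mathcal{P}_{\mathcal{S}}$ is Euclidean projection onto a closed convex set $\mathcal{S}$; $\mathcal{N}(M)$ is the null space of $M$; $A_{\mathcal{I}}$ is the submatrix of $A$ with rows indexed by $\mathcal{I}$. For $x\in\Omega$: $\mathcal{A}(x)=\{i:(Ax-b)_i=0\}$, $\mathcal{F}(x)=\{i:(Ax-b)_i<0\}$. For $\alpha\ge0$: $y(x,\alpha)=\mathcal{P}_\Omega(x-\alpha g(x))$ and $d^\alpha(x)=y(x,\alpha)-x$. $E(x)=\|d^1(x)\|$. $g^{\mathcal{A}}(x)=\mathcal{P}_{\mathcal{N}(A_{\mathcal{I}})}(g(x))$ with $\mathcal{I}=\mathcal{A}(x)$ (equal to $g(x)$ if $\mathcal{A}(x)=\emptyset$), and $e(x)=\|g^{\mathcal{A}}(x)\|$. Undecided index set: $\lambda(x)\in\mathbb{R}^m$ is any vector satisfying, with $y=y(x,1)$, $y-x+g(x)+A^{T}\lambda(x)=0$, $\lambda(x)\ge0$, $\lambda_i(x)=0$ for $i\in\mathcal{F}(y)$.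 Given $\beta\in(1,2)$, $\gamma\in(0,1)$, $\mathcal{U}(x)=\{i:\lambda_i(x)\ge E(x)^\gamma \text{ and } (b-Ax)_i\ge E(x)^\beta\}$. GPA iteration (parameters $\delta,\eta\in(0,1)$, $\alpha\in(0,\infty)$): $d_k=y(x_k,\alpha)-x_k$; $s_k=\eta^j$ where $j\ge0$ is the smallest integer with $f(x_k+s_kd_k)\le f(x_k)+s_k\delta\nabla f(x_k)d_k$; $x_{k+1}=x_k+s_kd_k$, $k\leftarrow k+1$. LCO is any iterative method, producing $x_{k+1}$ from $x_k$ in phase two, such that on phase-two iterations: (F1) $x_k\in\Omega$ and $f(x_{k+1})\le f(x_k)$ for each $k$; (F2) $\mathcal{A}(x_k)\subset\mathcal{A}(x_{k+1})$ for each $k$; (F3) if (phase two continues indefinitely and) $\mathcal{A}(x_{j+1})=\mathcal{A}(x_j)$ for all $j\ge k$, then $\liminf_{j\to\infty}e(x_j)=0$. PASA (parameters $\epsilon\in[0,\infty)$; initial $\theta\in(0,1)$; $\mu\in(0,1)$; starting guess $x_0\in\mathbb{R}^n$): set $x_1=\mathcal{P}_\Omega(x_0)$, $k=1$, and start in phase one. Phase one: while $E(x_k)>\epsilon$, execute a GPA iteration, and then, at the current iterate $x_k$: if $\mathcal{U}(x_k)=\emptyset$ and $e(x_k)<\theta E(x_k)$, set $\theta\leftarrow\mu\theta$; if $e(x_k)\ge\theta E(x_k)$, go to phase two. Phase two: while $E(x_k)>\epsilon$, execute an LCO iteration, and then, at the current iterate $x_k$: if $e(x_k)<\theta E(x_k)$,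 go to phase one. PASA terminates when $E(x_k)\le\epsilon$. *)

theory Defs
  imports "HOL-Analysis.Analysis"
begin

text \<open>
  Throughout, \<open>g\<close> is the gradient of the objective \<open>f\<close> as a column vector, so that the
  product of the row vector \<open>\<nabla>f(x)\<close> with \<open>d\<close> is \<open>g x \<bullet> d\<close>.
\<close>

definition feasible :: "real^'n^'m \<Rightarrow> real^'m \<Rightarrow> (real^'n) set" where
  "feasible A b = {x. \<forall>i. (A *v x) $ i \<le> b $ i}"

definition stationary_point ::
  "(real^'n \<Rightarrow> real^'n) \<Rightarrow> real^'n^'m \<Rightarrow> real^'m \<Rightarrow> real^'n \<Rightarrow> bool" where
  "stationary_point g A b x \<longleftrightarrow>
     x \<in> feasible A b \<and> (\<forall>z\<in>feasible A b. g x \<bullet> (z - x) \<ge> 0)"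

definition active_set :: "real^'n^'m \<Rightarrow> real^'m \<Rightarrow> real^'n \<Rightarrow> 'm set" where
  "active_set A b x = {i. (A *v x - b) $ i = 0}"

definition free_set :: "real^'n^'m \<Rightarrow> real^'m \<Rightarrow> real^'n \<Rightarrow> 'm set" where
  "free_set A b x = {i. (A *v x - b) $ i < 0}"

definition proj_point ::
  "(real^'n \<Rightarrow> real^'n) \<Rightarrow> real^'n^'m \<Rightarrow> real^'m \<Rightarrow> real^'n \<Rightarrow> real \<Rightarrow> real^'n" where
  "proj_point g A b x \<alpha> = closest_point (feasible A b) (x - \<alpha> *\<^sub>R g x)"

definition proj_dir ::
  "(real^'n \<Rightarrow> real^'n) \<Rightarrow> real^'n^'m \<Rightarrow> real^'m \<Rightarrow> real \<Rightarrow> real^'n \<Rightarrow> real^'n" where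
  "proj_dir g A b \<alpha> x = proj_point g A b x \<alpha> - x"

definition global_err ::
  "(real^'n \<Rightarrow> real^'n) \<Rightarrow> real^'n^'m \<Rightarrow> real^'m \<Rightarrow> real^'n \<Rightarrow> real" where
  "global_err g A b x = norm (proj_dir g A b 1 x)"

definition null_space_rows :: "real^'n^'m \<Rightarrow> 'm set \<Rightarrow> (real^'n) set" where
  "null_space_rows A I = {v. \<forall>i\<in>I. (A *v v) $ i = 0}"

definition active_grad ::
  "(real^'n \<Rightarrow> real^'n) \<Rightarrow> real^'n^'m \<Rightarrow> real^'m \<Rightarrow> real^'n \<Rightarrow> real^'n" where
  "active_grad g A b x = closest_point (null_space_rows A (active_set A b x)) (g x)"

definition local_err ::
  "(real^'n \<Rightarrow> real^'n) \<Rightarrow> real^'n^'m \<Rightarrow> real^'m \<Rightarrow> real^'n \<Rightarrow> real" where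
  "local_err g A b x = norm (active_grad g A b x)"

definition is_multiplier ::
  "(real^'n \<Rightarrow> real^'n) \<Rightarrow> real^'n^'m \<Rightarrow> real^'m \<Rightarrow> real^'n \<Rightarrow> real^'m \<Rightarrow> bool" where
  "is_multiplier g A b x l \<longleftrightarrow>
     (let y = proj_point g A b x 1 in
        y - x + g x + transpose A *v l = 0 \<and>
        (\<forall>i. l $ i \<ge> 0) \<and>
        (\<forall>i\<in>free_set A b y. l $ i = 0))"

definition undecided_set ::
  "(real^'n \<Rightarrow> real^'n) \<Rightarrow> real^'n^'m \<Rightarrow> real^'m \<Rightarrow> (real^'n \<Rightarrow> real^'m) \<Rightarrow>
   real \<Rightarrow> real \<Rightarrow> real^'n \<Rightarrow> 'm set" where
  "undecided_set g A b lam \<beta> \<gamma> x =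
     {i. lam x $ i \<ge> global_err g A b x powr \<gamma> \<and>
         (b - A *v x) $ i \<ge> global_err g A b x powr \<beta>}"

text \<open>One iteration of the gradient projection algorithm with Armijo backtracking.\<close>

definition armijo ::
  "(real^'n \<Rightarrow> real) \<Rightarrow> (real^'n \<Rightarrow> real^'n) \<Rightarrow> real \<Rightarrow> real^'n \<Rightarrow> real^'n \<Rightarrow> real \<Rightarrow> bool" where
  "armijo f g \<delta> x d s \<longleftrightarrow> f (x + s *\<^sub>R d) \<le> f x + s * \<delta> * (g x \<bullet> d)"

definition gpa_next ::
  "(real^'n \<Rightarrow> real) \<Rightarrow> (real^'n \<Rightarrow> real^'n) \<Rightarrow> real^'n^'m \<Rightarrow> real^'m \<Rightarrow>
   real \<Rightarrow> real \<Rightarrow> real \<Rightarrow> real^'n \<Rightarrow> real^'n" where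
  "gpa_next f g A b \<delta> \<eta> \<alpha> x =
     (let d = proj_dir g A b \<alpha> x;
          s = \<eta> ^ (LEAST j. armijo f g \<delta> x d (\<eta> ^ j))
      in x + s *\<^sub>R d)"

datatype phase = Phase_One | Phase_Two

text \<open>
  \<open>executed E \<epsilon> x k\<close>: the method has not terminated at any of the iterates
  \<open>x 1, \<dots>, x k\<close>, so that it performs the iteration leading from \<open>x k\<close> to \<open>x (Suc k)\<close>.
  Iterates beyond a terminal one are unconstrained and have no meaning.
\<close>

definition executed :: "(real^'n \<Rightarrow> real) \<Rightarrow> real \<Rightarrow> (nat \<Rightarrow> real^'n) \<Rightarrow> nat \<Rightarrow> bool" where
  "executed E \<epsilon> x k \<longleftrightarrow> k \<ge> 1 \<and> (\<forall>j\<in>{1..k}. E (x j) > \<epsilon>)"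

definition terminates_at :: "(real^'n \<Rightarrow> real) \<Rightarrow> real \<Rightarrow> (nat \<Rightarrow> real^'n) \<Rightarrow> nat \<Rightarrow> bool" where
  "terminates_at E \<epsilon> x k \<longleftrightarrow> k \<ge> 1 \<and> E (x k) \<le> \<epsilon> \<and> (\<forall>j\<in>{1..<k}. E (x j) > \<epsilon>)"

text \<open>
  \<open>pasa_run\<close> describes the sequences generated by PASA: \<open>x 0\<close> is the starting guess, and for
  \<open>k \<ge> 1\<close>, \<open>x k\<close> is the \<open>k\<close>-th iterate, \<open>\<theta> k\<close> the value of the parameter \<open>\<theta>\<close> and \<open>ph k\<close>
  the phase in which the iteration from \<open>x k\<close> to \<open>x (Suc k)\<close> is performed.  The two tests in
  phase one are carried out in sequence, so the second one uses the possibly reduced \<open>\<theta>\<close>.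
  The iteration of the linearly constrained optimizer is \<open>lco k (x k)\<close>; the dependence on
  \<open>k\<close> accounts for any memory of earlier iterates that the optimizer may keep.
\<close>

definition pasa_run ::
  "(real^'n \<Rightarrow> real) \<Rightarrow> (real^'n \<Rightarrow> real^'n) \<Rightarrow> real^'n^'m \<Rightarrow> real^'m \<Rightarrow>
   real \<Rightarrow> real \<Rightarrow> real \<Rightarrow> (real^'n \<Rightarrow> real^'m) \<Rightarrow> real \<Rightarrow> real \<Rightarrow>
   (nat \<Rightarrow> real^'n \<Rightarrow> real^'n) \<Rightarrow> real \<Rightarrow> real \<Rightarrow> real \<Rightarrow>
   (nat \<Rightarrow> real^'n) \<Rightarrow> (nat \<Rightarrow> real) \<Rightarrow> (nat \<Rightarrow> phase) \<Rightarrow> bool" where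
  "pasa_run f g A b \<delta> \<eta> \<alpha> lam \<beta> \<gamma> lco \<epsilon> \<theta>0 \<mu> x \<theta> ph \<longleftrightarrow>
     (let E = global_err g A b; e = local_err g A b; U = undecided_set g A b lam \<beta> \<gamma> in
      x 1 = closest_point (feasible A b) (x 0) \<and> \<theta> 1 = \<theta>0 \<and> ph 1 = Phase_One \<and>
      (\<forall>k. executed E \<epsilon> x k \<longrightarrow>
        (let z = x (Suc k) in
         case ph k of
           Phase_One \<Rightarrow>
             z = gpa_next f g A b \<delta> \<eta> \<alpha> (x k) \<and>
             \<theta> (Suc k) = (if U z = {} \<and> e z < \<theta> k * E z then \<mu> * \<theta> k else \<theta> k) \<and>
             ph (Suc k) = (if e z \<ge> \<theta> (Suc k) * E z then Phase_Two else Phase_One)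
         | Phase_Two \<Rightarrow>
             z = lco k (x k) \<and>
             \<theta> (Suc k) = \<theta> k \<and>
             ph (Suc k) = (if e z < \<theta> k * E z then Phase_One else Phase_Two))))"

definition gpa_iterations ::
  "(real^'n \<Rightarrow> real) \<Rightarrow> real \<Rightarrow> (nat \<Rightarrow> real^'n) \<Rightarrow> (nat \<Rightarrow> phase) \<Rightarrow> nat set" where
  "gpa_iterations E \<epsilon> x ph = {k. executed E \<epsilon> x k \<and> ph k = Phase_One}"

definition lco_iterations ::
  "(real^'n \<Rightarrow> real) \<Rightarrow> real \<Rightarrow> (nat \<Rightarrow> real^'n) \<Rightarrow> (nat \<Rightarrow> phase) \<Rightarrow> nat set" where
  "lco_iterations E \<epsilon> x ph = {k. executed E \<epsilon> x k \<and> ph k = Phase_Two}"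

text \<open>
  The requirements on the optimizer, for the set \<open>K\<close> of indices of phase two iterations.
  In \<open>lco_F1\<close>, the feasibility of \<open>x (Suc k)\<close> covers the last iterate generated before a
  return to phase one.
\<close>

definition lco_F1 ::
  "(real^'n \<Rightarrow> real) \<Rightarrow> real^'n^'m \<Rightarrow> real^'m \<Rightarrow> nat set \<Rightarrow> (nat \<Rightarrow> real^'n) \<Rightarrow> bool" where
  "lco_F1 f A b K x \<longleftrightarrow>
     (\<forall>k\<in>K. x k \<in> feasible A b \<and> x (Suc k) \<in> feasible A b \<and> f (x (Suc k)) \<le> f (x k))"

definition lco_F2 ::
  "real^'n^'m \<Rightarrow> real^'m \<Rightarrow> nat set \<Rightarrow> (nat \<Rightarrow> real^'n) \<Rightarrow> bool" where
  "lco_F2 A b K x \<longleftrightarrow> (\<forall>k\<in>K. active_set A b (x k) \<subseteq> active_set A b (x (Suc k)))"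

definition lco_F3 ::
  "(real^'n \<Rightarrow> real^'n) \<Rightarrow> real^'n^'m \<Rightarrow> real^'m \<Rightarrow> nat set \<Rightarrow> (nat \<Rightarrow> real^'n) \<Rightarrow> bool" where
  "lco_F3 g A b K x \<longleftrightarrow>
     (\<forall>k. (\<forall>j\<ge>k. j \<in> K \<and> active_set A b (x (Suc j)) = active_set A b (x j)) \<longrightarrow>
          liminf (\<lambda>j. ereal (local_err g A b (x j))) = 0)"

definition level_set ::
  "(real^'n \<Rightarrow> real) \<Rightarrow> real^'n^'m \<Rightarrow> real^'m \<Rightarrow> real^'n \<Rightarrow> (real^'n) set" where
  "level_set f A b x1 = {x \<in> feasible A b. f x \<le> f x1}"

definition enlarged_level_set ::
  "(real^'n \<Rightarrow> real) \<Rightarrow> real^'n^'m \<Rightarrow> real^'m \<Rightarrow> real^'n \<Rightarrow> real \<Rightarrow> (real^'n) set" where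
  "enlarged_level_set f A b x1 r = {x \<in> feasible A b. infdist x (level_set f A b x1) \<le> r}"

definition gpa_dir_norms ::
  "(real^'n \<Rightarrow> real^'n) \<Rightarrow> real^'n^'m \<Rightarrow> real^'m \<Rightarrow> real \<Rightarrow> nat set \<Rightarrow> (nat \<Rightarrow> real^'n) \<Rightarrow> real set"
where
  "gpa_dir_norms g A b \<alpha> K x = (\<lambda>k. norm (proj_dir g A b \<alpha> (x k))) ` K"

text \<open>
  The element \<open>0\<close> only matters when no phase one iteration is performed: the supremum of
  the empty set of norms is \<open>0\<close>.
\<close>

definition d_max ::
  "(real^'n \<Rightarrow> real^'n) \<Rightarrow> real^'n^'m \<Rightarrow> real^'m \<Rightarrow> real \<Rightarrow> nat set \<Rightarrow> (nat \<Rightarrow> real^'n) \<Rightarrow> real"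
where
  "d_max g A b \<alpha> K x = Sup (insert 0 (gpa_dir_norms g A b \<alpha> K x))"

end

theory Submission
  imports Defs
begin

text \<open>
  Write \<open>E\<close> for \<open>global_err\<close> and \<open>e\<close> for \<open>local_err\<close>. If the run stops, \<open>E\<close> vanishes at the last
  iterate, and a vanishing projected gradient direction is precisely stationarity.

  Suppose that the run is infinite and that \<open>E (x k)\<close> stays above some \<open>\<tau> > 0\<close> from some index
  on. A projected gradient direction \<open>d\<close> of length \<open>\<ell>\<close> is a descent direction of slope at most
  \<open>-\<ell>\<^sup>2/\<alpha>\<close>, and \<open>\<ell> \<ge> min 1 \<alpha> * E\<close>. The Lipschitz condition on the gradient keeps the Armijo steps
  away from zero, so each phase one iteration beyond that index lowers \<open>f\<close> by at least a fixed
  positive amount (\<open>gpa_sufficient_decrease\<close>). Phase two never raises \<open>f\<close>, and \<open>f\<close> is bounded below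
  along the iterates, so only finitely many phase one iterations occur
  (\<open>finite_uniform_decreases\<close>).

  Hence the method finally stays in phase two. There \<open>\<theta>\<close> is a positive constant, and remaining in
  phase two means that \<open>e (x k) \<ge> \<theta> * E (x k) \<ge> \<theta> * \<tau>\<close>. The active sets grow inside a finite index
  set and must become stationary (\<open>increasing_finite_sets_stabilize\<close>), so the hypothesis on the
  optimizer yields \<open>liminf e = 0\<close>, a contradiction.
\<close>

section \<open>Projected gradient directions\<close>

lemma feasible_eq_Inter_halfspaces:
  "feasible A b = (\<Inter>i. {x. row i A \<bullet> x \<le> b $ i})"
  by (auto simp: feasible_def matrix_vector_mul_component row_def)

lemma closed_feasible: "closed (feasible A b)"
  unfolding feasible_eq_Inter_halfspaces by (auto intro: closed_halfspace_le)

lemma convex_feasible: "convex (feasible A b)"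
  unfolding feasible_eq_Inter_halfspaces by (auto intro: convex_INT convex_halfspace_le)

lemma proj_point_feasible:
  "feasible A b \<noteq> {} \<Longrightarrow> proj_point g A b x \<alpha> \<in> feasible A b"
  unfolding proj_point_def by (rule closest_point_in_set[OF closed_feasible])

text \<open>
  The obtuse angle criterion for the projection, rewritten in terms of the direction. Testing it
  at \<open>z = x\<close> bounds the slope of \<open>f\<close> along the direction; if the direction for \<open>\<alpha> = 1\<close>
  vanishes, it is the stationarity condition.
\<close>

lemma proj_dir_variational:
  assumes "z \<in> feasible A b"
  shows "(\<alpha> *\<^sub>R g x + proj_dir g A b \<alpha> x) \<bullet> (z - x - proj_dir g A b \<alpha> x) \<ge> 0"
proof -
  define p where "p = proj_point g A b x \<alpha>"
  have "(x - \<alpha> *\<^sub>R g x - p) \<bullet> (z - p) \<le> 0"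
    unfolding p_def proj_point_def by (rule closest_point_dot[OF convex_feasible closed_feasible assms])
  moreover have "\<alpha> *\<^sub>R g x + (p - x) = - (x - \<alpha> *\<^sub>R g x - p)" "z - x - (p - x) = z - p"
    by simp_all
  ultimately show ?thesis
    unfolding proj_dir_def p_def[symmetric] by (simp only: inner_minus_left neg_0_le_iff_le)
qed

lemma proj_dir_slope:
  assumes "x \<in> feasible A b"
  shows "\<alpha> * (g x \<bullet> proj_dir g A b \<alpha> x) \<le> - (norm (proj_dir g A b \<alpha> x))\<^sup>2"
  using proj_dir_variational[OF assms, of \<alpha> g x]
  by (simp add: inner_add_left power2_norm_eq_inner)

text \<open>
  The variational inequalities of the two projections, each tested at the other projected point,
  combine to \<open>(d\<^sub>\<alpha> - \<alpha> d\<^sub>1) \<bullet> (d\<^sub>\<alpha> - d\<^sub>1) \<le> 0\<close>. By the Cauchy-Schwarz inequality the norm of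
  \<open>d\<^sub>\<alpha>\<close> then lies between the norms of \<open>d\<^sub>1\<close> and \<open>\<alpha> d\<^sub>1\<close>.
\<close>

lemma norm_proj_dir_ge_global_err:
  assumes "feasible A b \<noteq> {}" "\<alpha> > 0"
  shows "min 1 \<alpha> * global_err g A b x \<le> norm (proj_dir g A b \<alpha> x)"
proof -
  define d where "d = proj_dir g A b \<alpha> x"
  define e where "e = proj_dir g A b 1 x"
  have d: "x + d \<in> feasible A b" and e: "x + e \<in> feasible A b"
    using proj_point_feasible[OF assms(1)] by (auto simp: d_def e_def proj_dir_def)
  have "(g x + e) \<bullet> (d - e) \<ge> 0"
    using proj_dir_variational[OF d, of 1 g x] by (simp add: e_def)
  then have "0 \<le> \<alpha> * ((g x + e) \<bullet> (d - e))"
    using assms(2) by simp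
  moreover have "0 \<le> (\<alpha> *\<^sub>R g x + d) \<bullet> (e - d)"
    using proj_dir_variational[OF e, of \<alpha> g x] by (simp add: d_def)
  ultimately have "0 \<le> \<alpha> * ((g x + e) \<bullet> (d - e)) + (\<alpha> *\<^sub>R g x + d) \<bullet> (e - d)"
    by (rule add_nonneg_nonneg)
  also have "\<dots> = (1 + \<alpha>) * (d \<bullet> e) - d \<bullet> d - \<alpha> * (e \<bullet> e)"
    unfolding inner_add_left inner_diff_right inner_scaleR_left inner_commute[of e d]
    by (simp only: ring_distribs)
  finally have "(norm d)\<^sup>2 + \<alpha> * (norm e)\<^sup>2 \<le> (1 + \<alpha>) * (d \<bullet> e)"
    unfolding power2_norm_eq_inner by simp
  also have "\<dots> \<le> (1 + \<alpha>) * (norm d * norm e)"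
    using assms(2) by (intro mult_left_mono norm_cauchy_schwarz) auto
  finally have prod: "(norm d - norm e) * (norm d - \<alpha> * norm e) \<le> 0"
    by (simp add: algebra_simps power2_eq_square)
  have "norm e \<le> norm d \<or> \<alpha> * norm e \<le> norm d"
    using prod by (smt (verit) mult_neg_neg)
  moreover have "min 1 \<alpha> * norm e \<le> norm e" "min 1 \<alpha> * norm e \<le> \<alpha> * norm e"
    using assms(2) by (auto intro: mult_left_le_one_le mult_right_mono)
  ultimately show ?thesis
    unfolding global_err_def d_def e_def by linarith
qed

lemma stationary_point_if_global_err_zero:
  assumes "x \<in> feasible A b" "global_err g A b x = 0"
  shows "stationary_point g A b x"
  using assms proj_dir_variational[of _ A b 1 g x]
  by (auto simp: stationary_point_def global_err_def)

section \<open>Sufficient decrease of a gradient projection step\<close>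

lemma mean_value_segment:
  fixes f :: "'a::real_inner \<Rightarrow> real"
  assumes grad: "\<And>z. GDERIV f z :> g z" and "s > 0"
  obtains t where "0 < t" "t < s" "f (x + s *\<^sub>R d) = f x + s * (g (x + t *\<^sub>R d) \<bullet> d)"
proof -
  have der: "((\<lambda>t. f (x + t *\<^sub>R d)) has_real_derivative g (x + t *\<^sub>R d) \<bullet> d) (at t)" for t
  proof -
    have "(f has_derivative (\<lambda>h. g (x + t *\<^sub>R d) \<bullet> h)) (at (x + t *\<^sub>R d))"
      using grad[of "x + t *\<^sub>R d"] by (simp add: gderiv_def inner_commute)
    moreover have "((\<lambda>t. x + t *\<^sub>R d) has_derivative (\<lambda>h. h *\<^sub>R d)) (at t)"
      by (auto intro!: derivative_eq_intros)
    ultimately have "((\<lambda>t. f (x + t *\<^sub>R d)) has_derivative (\<lambda>h. g (x + t *\<^sub>R d) \<bullet> (h *\<^sub>R d))) (at t)"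
      using has_derivative_compose by blast
    then show ?thesis
      unfolding has_field_derivative_def
      by (rule has_derivative_eq_rhs) (simp add: fun_eq_iff mult.commute)
  qed
  obtain t where "0 < t" "t < s"
      "f (x + s *\<^sub>R d) - f (x + 0 *\<^sub>R d) = (s - 0) * (g (x + t *\<^sub>R d) \<bullet> d)"
    using MVT2[OF \<open>s > 0\<close> der] by blast
  then show thesis using that[of t] by simp
qed

text \<open>
  By the mean value theorem the change of \<open>f\<close> along a step \<open>s\<close> exceeds its linearization by at
  most \<open>C * s\<^sup>2 * (norm d)\<^sup>2\<close>, and the slope bound provides \<open>(1 - \<delta>) * s * (norm d)\<^sup>2 / \<alpha>\<close> to absorb
  this excess.
\<close>

lemma armijo_if_small_step:
  fixes f :: "real^'n \<Rightarrow> real"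
  assumes grad: "\<And>z. GDERIV f z :> g z"
    and lip: "C-lipschitz_on S g"
    and seg: "\<And>t. 0 \<le> t \<Longrightarrow> t \<le> s \<Longrightarrow> x + t *\<^sub>R d \<in> S"
    and slope: "\<alpha> * (g x \<bullet> d) \<le> - (norm d)\<^sup>2"
    and "\<alpha> > 0" "s > 0" and \<delta>: "\<delta> < 1" and small: "C * \<alpha> * s \<le> 1 - \<delta>"
  shows "armijo f g \<delta> x d s"
proof -
  obtain t where t: "0 < t" "t < s"
    and mvt: "f (x + s *\<^sub>R d) = f x + s * (g (x + t *\<^sub>R d) \<bullet> d)"
    using mean_value_segment[OF grad \<open>s > 0\<close>] by blast
  have C: "C \<ge> 0" using lip by (rule lipschitz_on_nonneg)
  have "norm (g (x + t *\<^sub>R d) - g x) \<le> C * norm (t *\<^sub>R d)"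
    using lipschitz_onD[OF lip seg[of t] seg[of 0]] t by (simp add: dist_norm)
  also have "\<dots> \<le> C * (s * norm d)"
    using t C by (auto intro!: mult_left_mono mult_right_mono)
  finally have "norm (g (x + t *\<^sub>R d) - g x) * norm d \<le> C * s * (norm d)\<^sup>2"
    using mult_right_mono[of _ _ "norm d"] by (fastforce simp: power2_eq_square)
  then have "(g (x + t *\<^sub>R d) - g x) \<bullet> d \<le> C * s * (norm d)\<^sup>2"
    using norm_cauchy_schwarz order_trans by blast
  then have "\<alpha> * ((g (x + t *\<^sub>R d) - g x) \<bullet> d) \<le> (C * \<alpha> * s) * (norm d)\<^sup>2"
    using \<open>\<alpha> > 0\<close> mult_left_mono[of _ _ \<alpha>] by (fastforce simp: mult_ac)
  also have "\<dots> \<le> (1 - \<delta>) * (norm d)\<^sup>2"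
    using small by (rule mult_right_mono) simp
  also have "\<dots> \<le> (1 - \<delta>) * - (\<alpha> * (g x \<bullet> d))"
    using slope \<delta> by (intro mult_left_mono) auto
  finally have "\<alpha> * (g (x + t *\<^sub>R d) \<bullet> d) \<le> \<alpha> * (\<delta> * (g x \<bullet> d))"
    by (simp add: algebra_simps inner_diff_left)
  then have "s * (g (x + t *\<^sub>R d) \<bullet> d) \<le> s * \<delta> * (g x \<bullet> d)"
    using \<open>\<alpha> > 0\<close> \<open>s > 0\<close> by simp
  then show ?thesis unfolding armijo_def mvt by simp
qed

text \<open>
  Backtracking stops at once or has just rejected a step larger than the threshold \<open>\<sigma>\<close>, which is
  what keeps the accepted step away from zero.
\<close>

lemma backtracking_step_bound:
  fixes \<eta> \<sigma> :: real
  assumes \<eta>: "0 < \<eta>" "\<eta> < 1" and "\<sigma> > 0"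
    and ok: "\<And>s. 0 < s \<Longrightarrow> s \<le> 1 \<Longrightarrow> s \<le> \<sigma> \<Longrightarrow> P s"
  defines "s \<equiv> \<eta> ^ (LEAST j. P (\<eta> ^ j))"
  shows "P s" "s \<ge> min 1 (\<eta> * \<sigma>)"
proof -
  let ?j = "LEAST j. P (\<eta> ^ j)"
  obtain n where "\<eta> ^ n < \<sigma>" using real_arch_pow_inv[OF \<open>\<sigma> > 0\<close> \<eta>(2)] by blast
  then have "P (\<eta> ^ n)" using \<eta> by (intro ok) (auto simp: power_le_one)
  then show "P s" unfolding s_def by (rule LeastI)
  show "s \<ge> min 1 (\<eta> * \<sigma>)"
  proof (cases ?j)
    case 0
    then show ?thesis by (simp add: s_def)
  next
    case (Suc i)
    have "\<not> P (\<eta> ^ i)" using not_less_Least[of i "\<lambda>j. P (\<eta> ^ j)"] Suc by simp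
    then have "\<eta> ^ i > \<sigma>" using ok[of "\<eta> ^ i"] \<eta> by (force simp: power_le_one)
    then have "\<eta> * \<sigma> \<le> s" using \<eta> by (simp add: s_def Suc)
    then show ?thesis by linarith
  qed
qed

lemma gpa_sufficient_decrease:
  fixes f :: "real^'n \<Rightarrow> real" and g :: "real^'n \<Rightarrow> real^'n"
    and A :: "real^'n^'m" and b :: "real^'m"
  assumes grad: "\<And>z. GDERIV f z :> g z"
    and \<delta>: "0 < \<delta>" "\<delta> < 1" and \<eta>: "0 < \<eta>" "\<eta> < 1" and "\<alpha> > 0" "C > 0"
    and lip: "C-lipschitz_on (enlarged_level_set f A b x1 r) g"
    and x: "x \<in> level_set f A b x1"
    and r: "norm (proj_dir g A b \<alpha> x) \<le> r"
  shows "gpa_next f g A b \<delta> \<eta> \<alpha> x \<in> feasible A b" (is ?feas)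
    and "f (gpa_next f g A b \<delta> \<eta> \<alpha> x) \<le> f x
      - \<delta> / \<alpha> * min 1 (\<eta> * ((1 - \<delta>) / (C * \<alpha>))) * (min 1 \<alpha> * global_err g A b x)\<^sup>2" (is ?decr)
proof -
  define d where "d = proj_dir g A b \<alpha> x"
  define \<sigma> where "\<sigma> = (1 - \<delta>) / (C * \<alpha>)"
  define s where "s = \<eta> ^ (LEAST j. armijo f g \<delta> x d (\<eta> ^ j))"
  have next_eq: "gpa_next f g A b \<delta> \<eta> \<alpha> x = x + s *\<^sub>R d"
    by (simp add: gpa_next_def Let_def s_def d_def)
  have "\<sigma> > 0" using \<delta> \<open>\<alpha> > 0\<close> \<open>C > 0\<close> by (simp add: \<sigma>_def)
  have xf: "x \<in> feasible A b" using x by (simp add: level_set_def)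
  then have ne: "feasible A b \<noteq> {}" by blast
  have xd: "x + d \<in> feasible A b"
    using proj_point_feasible[OF ne] by (simp add: d_def proj_dir_def)
  have feas: "x + t *\<^sub>R d \<in> feasible A b" if "0 \<le> t" "t \<le> 1" for t
  proof -
    have "(1 - t) *\<^sub>R x + t *\<^sub>R (x + d) \<in> feasible A b"
      using convexD_alt[OF convex_feasible xf xd] that by blast
    then show ?thesis by (simp add: algebra_simps)
  qed
  have seg: "x + t *\<^sub>R d \<in> enlarged_level_set f A b x1 r" if "0 \<le> t" "t \<le> 1" for t
  proof -
    have "infdist (x + t *\<^sub>R d) (level_set f A b x1) \<le> dist (x + t *\<^sub>R d) x"
      by (rule infdist_le[OF x])
    also have "\<dots> \<le> norm d" using that by (simp add: dist_norm mult_left_le_one_le)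
    finally show ?thesis using r feas[OF that] by (simp add: enlarged_level_set_def d_def)
  qed
  have slope: "\<alpha> * (g x \<bullet> d) \<le> - (norm d)\<^sup>2"
    unfolding d_def by (rule proj_dir_slope[OF xf])
  have ok: "armijo f g \<delta> x d u" if u: "0 < u" "u \<le> 1" "u \<le> \<sigma>" for u
  proof (rule armijo_if_small_step[OF grad lip _ slope \<open>\<alpha> > 0\<close> u(1) \<delta>(2)])
    show "x + t *\<^sub>R d \<in> enlarged_level_set f A b x1 r" if "0 \<le> t" "t \<le> u" for t
      using seg that u by simp
    show "C * \<alpha> * u \<le> 1 - \<delta>"
      using u(3) \<open>\<alpha> > 0\<close> \<open>C > 0\<close> by (simp add: \<sigma>_def field_simps)
  qed
  have arm: "armijo f g \<delta> x d s" and s_ge: "s \<ge> min 1 (\<eta> * \<sigma>)"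
    unfolding s_def using backtracking_step_bound[OF \<eta> \<open>\<sigma> > 0\<close>, of "armijo f g \<delta> x d"] ok
    by blast+
  have "0 \<le> s" "s \<le> 1" using \<eta> by (auto simp: s_def power_le_one)
  then show ?feas unfolding next_eq by (rule feas)
  have err: "(min 1 \<alpha> * global_err g A b x)\<^sup>2 \<le> (norm d)\<^sup>2"
    unfolding d_def using norm_proj_dir_ge_global_err[OF ne \<open>\<alpha> > 0\<close>] \<open>\<alpha> > 0\<close>
    by (intro power_mono) (auto simp: global_err_def)
  have "min 1 (\<eta> * \<sigma>) * (min 1 \<alpha> * global_err g A b x)\<^sup>2 \<le> s * (norm d)\<^sup>2"
    using s_ge err \<open>0 \<le> s\<close> by (intro mult_mono) auto
  also have "\<dots> \<le> s * (- (\<alpha> * (g x \<bullet> d)))"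
    using slope \<open>0 \<le> s\<close> by (intro mult_left_mono) auto
  finally have "\<delta> / \<alpha> * (min 1 (\<eta> * \<sigma>) * (min 1 \<alpha> * global_err g A b x)\<^sup>2)
      \<le> \<delta> / \<alpha> * (s * (- (\<alpha> * (g x \<bullet> d))))"
    using \<delta> \<open>\<alpha> > 0\<close> by (intro mult_left_mono) auto
  also have "\<dots> = - (s * \<delta> * (g x \<bullet> d))"
    using \<open>\<alpha> > 0\<close> by simp
  finally show ?decr
    using arm unfolding next_eq armijo_def \<sigma>_def by (simp add: mult.assoc)
qed

section \<open>Two stabilization principles\<close>

lemma finite_uniform_decreases:
  fixes F :: "nat \<Rightarrow> real"
  assumes mono: "\<And>k. k \<ge> N \<Longrightarrow> F (Suc k) \<le> F k"
    and below: "\<And>k. k \<ge> N \<Longrightarrow> m \<le> F k"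
    and decr: "\<And>k. k \<in> K \<Longrightarrow> k \<ge> N \<Longrightarrow> F (Suc k) \<le> F k - c" and "c > 0"
  shows "finite K"
proof -
  define G where "G k = F (k + N)" for k
  have "decseq G" using mono by (simp add: G_def decseq_Suc_iff)
  moreover have "\<And>k. m \<le> G k" using below by (simp add: G_def)
  ultimately obtain l where "G \<longlonglongrightarrow> l" using decseq_convergent by blast
  then have F: "F \<longlonglongrightarrow> l" unfolding G_def by (rule LIMSEQ_offset)
  have "(\<lambda>k. F k - F (Suc k)) \<longlonglongrightarrow> l - l"
    by (intro tendsto_diff F LIMSEQ_Suc)
  then have "\<forall>\<^sub>F k in sequentially. F k - F (Suc k) < c"
    using \<open>c > 0\<close> by (auto dest: order_tendstoD)
  then have "\<forall>\<^sub>F k in sequentially. k \<notin> K"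
    using eventually_ge_at_top[of N] by eventually_elim (use decr in force)
  then show ?thesis
    by (metis eventually_sequentially finite_nat_set_iff_bounded linorder_not_less)
qed

lemma increasing_finite_sets_stabilize:
  fixes S :: "nat \<Rightarrow> 'a::finite set"
  assumes "\<And>k. k \<ge> N \<Longrightarrow> S k \<subseteq> S (Suc k)"
  obtains M where "M \<ge> N" "\<And>k. k \<ge> M \<Longrightarrow> S (Suc k) = S k"
proof -
  have bound: "\<forall>k. k \<ge> N \<longrightarrow> card (S k) < Suc CARD('a)"
    using card_mono[OF finite subset_UNIV] le_imp_less_Suc by blast
  have "\<exists>M. M \<ge> N \<and> (\<forall>k. k \<ge> N \<longrightarrow> card (S k) \<le> card (S M))"
    by (rule ex_has_greatest_nat[OF order_refl bound])
  then obtain M where M: "M \<ge> N" "\<And>k. k \<ge> N \<Longrightarrow> card (S k) \<le> card (S M)" by blast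
  have eq: "S k = S M" if "k \<ge> M" for k
    using that
  proof (induction k rule: dec_induct)
    case (step k)
    have "k \<ge> N" using step.hyps(1) M(1) by linarith
    then have "S M \<subseteq> S (Suc k)" using assms[of k] step.IH by simp
    moreover have "card (S (Suc k)) \<le> card (S M)" using \<open>k \<ge> N\<close> by (intro M(2)) linarith
    ultimately show ?case using card_seteq[OF finite] by blast
  qed simp
  show thesis
  proof (rule that[OF M(1)])
    show "S (Suc k) = S k" if "k \<ge> M" for k
      using eq[of k] eq[of "Suc k"] that by (metis le_SucI)
  qed
qed

section \<open>Convergence of the method\<close>

theorem theorem3p2:
  fixes f :: "real^'n \<Rightarrow> real" and g :: "real^'n \<Rightarrow> real^'n"
    and A :: "real^'n^'m" and b :: "real^'m"
    and lam :: "real^'n \<Rightarrow> real^'m"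
    and lco :: "nat \<Rightarrow> real^'n \<Rightarrow> real^'n"
    and \<alpha> \<beta> \<gamma> \<delta> \<eta> \<mu> \<theta>0 :: real
    and x :: "nat \<Rightarrow> real^'n" and \<theta> :: "nat \<Rightarrow> real" and ph :: "nat \<Rightarrow> phase"
  defines "E \<equiv> global_err g A b"
  defines "K1 \<equiv> gpa_iterations E 0 x ph" and "K2 \<equiv> lco_iterations E 0 x ph"
  assumes grad: "\<And>z. GDERIV f z :> g z" and grad_cont: "continuous_on UNIV g"
    and nonempty: "feasible A b \<noteq> {}"
    and gpa_params: "\<delta> \<in> {0<..<1}" "\<eta> \<in> {0<..<1}" "\<alpha> > 0"
    and undecided_params: "\<beta> \<in> {1<..<2}" "\<gamma> \<in> {0<..<1}"
    and pasa_params: "\<theta>0 \<in> {0<..<1}" "\<mu> \<in> {0<..<1}"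
    and lam: "\<And>z. z \<in> feasible A b \<Longrightarrow> is_multiplier g A b z (lam z)"
    and run: "pasa_run f g A b \<delta> \<eta> \<alpha> lam \<beta> \<gamma> lco 0 \<theta>0 \<mu> x \<theta> ph"
    and A1: "bdd_below (f ` level_set f A b (x 1))" "bdd_above (gpa_dir_norms g A b \<alpha> K1 x)"
    and A2: "\<exists>C. C-lipschitz_on (enlarged_level_set f A b (x 1) (d_max g A b \<alpha> K1 x)) g"
    and F1: "lco_F1 f A b K2 x" and F2: "lco_F2 A b K2 x" and F3: "lco_F3 g A b K2 x"
  shows "(\<exists>k. terminates_at E 0 x k \<and> stationary_point g A b (x k)) \<or>
         ((\<forall>k\<ge>1. executed E 0 x k) \<and> liminf (\<lambda>k. ereal (E (x k))) = 0)"
proof -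
  define e where "e = local_err g A b"
  define L where "L = level_set f A b (x 1)"
  define r where "r = d_max g A b \<alpha> K1 x"
  have x1: "x 1 = closest_point (feasible A b) (x 0)" and \<theta>1: "\<theta> 1 = \<theta>0" and ph1: "ph 1 = Phase_One"
    using run by (auto simp: pasa_run_def Let_def)
  have run_step: "case ph k of
      Phase_One \<Rightarrow> x (Suc k) = gpa_next f g A b \<delta> \<eta> \<alpha> (x k) \<and>
        \<theta> (Suc k) = (if undecided_set g A b lam \<beta> \<gamma> (x (Suc k)) = {} \<and>
          e (x (Suc k)) < \<theta> k * E (x (Suc k)) then \<mu> * \<theta> k else \<theta> k)
    | Phase_Two \<Rightarrow> \<theta> (Suc k) = \<theta> k \<and>
        ph (Suc k) = (if e (x (Suc k)) < \<theta> k * E (x (Suc k)) then Phase_One else Phase_Two)"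
    if "executed E 0 x k" for k
    using run that unfolding pasa_run_def Let_def E_def e_def by (auto split: phase.splits)
  have one: "x (Suc k) = gpa_next f g A b \<delta> \<eta> \<alpha> (x k)"
      "\<theta> (Suc k) = \<theta> k \<or> \<theta> (Suc k) = \<mu> * \<theta> k" if "k \<in> K1" for k
    using run_step[of k] that unfolding K1_def gpa_iterations_def by (auto split: if_splits)
  have two: "\<theta> (Suc k) = \<theta> k"
      "ph (Suc k) = (if e (x (Suc k)) < \<theta> k * E (x (Suc k)) then Phase_One else Phase_Two)"
    if "k \<in> K2" for k
    using run_step[of k] that unfolding K2_def lco_iterations_def by auto
  have cases_phase: "k \<in> K1 \<or> k \<in> K2" if "executed E 0 x k" for k
    using that by (cases "ph k") (auto simp: K1_def K2_def gpa_iterations_def lco_iterations_def)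
  have E_nonneg: "E z \<ge> 0" for z by (simp add: E_def global_err_def)

  \<comment> \<open>The Armijo threshold divides by the Lipschitz constant, so it is taken positive.\<close>
  obtain C where "C > 0" and lip: "C-lipschitz_on (enlarged_level_set f A b (x 1) r) g"
  proof -
    obtain C0 where C0: "C0-lipschitz_on (enlarged_level_set f A b (x 1) r) g"
      using A2 unfolding r_def by blast
    have "(C0 + 1)-lipschitz_on (enlarged_level_set f A b (x 1) r) g"
      by (rule lipschitz_on_le[OF C0]) simp
    moreover have "C0 + 1 > 0" using lipschitz_on_nonneg[OF C0] by simp
    ultimately show thesis using that by blast
  qed
  define c where "c = \<delta> / \<alpha> * min 1 (\<eta> * ((1 - \<delta>) / (C * \<alpha>)))"
  have "c > 0" using gpa_params \<open>C > 0\<close> by (simp add: c_def)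
  have dir: "norm (proj_dir g A b \<alpha> (x k)) \<le> r" if "k \<in> K1" for k
    unfolding r_def d_max_def using A1(2) that
    by (intro cSup_upper) (auto simp: gpa_dir_norms_def)
  have gpa: "x (Suc k) \<in> feasible A b"
      "f (x (Suc k)) \<le> f (x k) - c * (min 1 \<alpha> * E (x k))\<^sup>2" if "k \<in> K1" "x k \<in> L" for k
    using gpa_sufficient_decrease[OF grad _ _ _ _ _ \<open>C > 0\<close> lip that(2)[unfolded L_def] dir[OF that(1)],
        of \<delta> \<eta>] gpa_params one(1)[OF that(1)]
    unfolding c_def E_def by auto
  have descent: "x (Suc k) \<in> L \<and> f (x (Suc k)) \<le> f (x k)" if "executed E 0 x k" "x k \<in> L" for k
  proof -
    have "x (Suc k) \<in> feasible A b \<and> f (x (Suc k)) \<le> f (x k)"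
      using cases_phase[OF that(1)]
    proof
      assume "k \<in> K1"
      moreover have "0 \<le> c * (min 1 \<alpha> * E (x k))\<^sup>2" using \<open>c > 0\<close> by simp
      ultimately show ?thesis using gpa[of k] that(2) by linarith
    next
      assume "k \<in> K2"
      then show ?thesis using F1 by (simp add: lco_F1_def)
    qed
    then show ?thesis using that(2) by (auto simp: L_def level_set_def)
  qed
  have in_L: "x k \<in> L" if "k \<ge> 1" "\<forall>j\<in>{1..<k}. E (x j) > 0" for k
    using that
  proof (induction k rule: dec_induct)
    case base
    have "x 1 \<in> feasible A b" unfolding x1 by (rule closest_point_in_set[OF closed_feasible nonempty])
    then show ?case by (simp add: L_def level_set_def)
  next
    case (step k)
    then have "executed E 0 x k" by (auto simp: executed_def)
    then show ?case using descent[of k] step by auto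
  qed
  show ?thesis
  proof (cases "\<exists>k\<ge>1. E (x k) \<le> 0")
    case True
    then obtain k where k: "k \<ge> 1" "E (x k) \<le> 0" "\<And>j. j < k \<Longrightarrow> \<not> (j \<ge> 1 \<and> E (x j) \<le> 0)"
      using exists_least_iff[of "\<lambda>k. k \<ge> 1 \<and> E (x k) \<le> 0"] by blast
    then have pos: "\<forall>j\<in>{1..<k}. E (x j) > 0" by force
    then have "terminates_at E 0 x k" using k by (simp add: terminates_at_def)
    moreover have "stationary_point g A b (x k)"
      using in_L[OF k(1) pos] k(2) E_nonneg[of "x k"]
      by (intro stationary_point_if_global_err_zero) (auto simp: L_def level_set_def E_def)
    ultimately show ?thesis by blast
  next
    case False
    then have exec: "executed E 0 x k" if "k \<ge> 1" for k
      using that by (force simp: executed_def)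
    have L: "x k \<in> L" if "k \<ge> 1" for k
      using that False by (intro in_L) force+
    have "liminf (\<lambda>k. ereal (E (x k))) = 0"
    proof (rule ccontr)
      assume "liminf (\<lambda>k. ereal (E (x k))) \<noteq> 0"
      moreover have "0 \<le> liminf (\<lambda>k. ereal (E (x k)))"
        by (rule Liminf_bounded) (simp add: E_nonneg)
      ultimately have "0 < liminf (\<lambda>k. ereal (E (x k)))" by simp
      then obtain \<tau> where "0 < ereal \<tau>" "ereal \<tau> < liminf (\<lambda>k. ereal (E (x k)))"
        using ereal_dense2 by blast
      then have "\<tau> > 0" and "\<forall>\<^sub>F k in sequentially. ereal \<tau> < ereal (E (x k))"
        by (auto dest: less_LiminfD)
      then obtain N0 where \<tau>: "\<And>k. k \<ge> N0 \<Longrightarrow> \<tau> < E (x k)"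
        by (auto simp: eventually_sequentially)

      obtain m where m: "\<And>z. z \<in> L \<Longrightarrow> m \<le> f z"
        using A1(1) by (auto simp: bdd_below_def L_def)
      have "finite K1"
      proof (rule finite_uniform_decreases[where F = "\<lambda>k. f (x k)" and N = "max 1 N0"])
        show "m \<le> f (x k)" if "k \<ge> max 1 N0" for k
          using m L that by simp
        show "f (x (Suc k)) \<le> f (x k)" if "k \<ge> max 1 N0" for k
          using descent[OF exec L] that by simp
        show "0 < c * (min 1 \<alpha> * \<tau>)\<^sup>2" using \<open>c > 0\<close> \<open>\<tau> > 0\<close> gpa_params by simp
        show "f (x (Suc k)) \<le> f (x k) - c * (min 1 \<alpha> * \<tau>)\<^sup>2" if "k \<in> K1" "k \<ge> max 1 N0" for k
        proof -
          have "(min 1 \<alpha> * \<tau>)\<^sup>2 \<le> (min 1 \<alpha> * E (x k))\<^sup>2"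
            using \<tau>[of k] that \<open>\<tau> > 0\<close> gpa_params by (intro power_mono mult_left_mono) auto
          then have "c * (min 1 \<alpha> * \<tau>)\<^sup>2 \<le> c * (min 1 \<alpha> * E (x k))\<^sup>2"
            using \<open>c > 0\<close> by simp
          then show ?thesis using gpa(2)[OF that(1) L] that(2) by simp
        qed
      qed
      then obtain N1 where "\<And>k. k \<in> K1 \<Longrightarrow> k < N1"
        by (auto simp: finite_nat_set_iff_bounded)
      then have K2: "k \<in> K2" if "k \<ge> max 1 N1" for k
        using cases_phase[OF exec] that by fastforce
      define N where "N = max N0 (max 1 N1)"

      have \<theta>_pos: "\<theta> k > 0" if "k \<ge> 1" for k
        using that
      proof (induction k rule: dec_induct)
        case base
        then show ?case using \<theta>1 pasa_params by simp
      next
        case (step k)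
        have "\<theta> (Suc k) = \<theta> k \<or> \<theta> (Suc k) = \<mu> * \<theta> k"
          using cases_phase[OF exec[OF step.hyps(1)]] one(2)[of k] two(1)[of k] by metis
        then show ?case using step.IH pasa_params(2) by (elim disjE) simp_all
      qed
      have \<theta>_const: "\<theta> k = \<theta> N" if "k \<ge> N" for k
        using that
      proof (induction k rule: dec_induct)
        case (step k)
        have "k \<in> K2" using step.hyps K2[of k] unfolding N_def by linarith
        then show ?case using two(1)[of k] step.IH by metis
      qed (rule refl)
      \<comment> \<open>The phase of iteration \<open>k\<close> is settled by the test at \<open>x k\<close>, made at the end of
        iteration \<open>k - 1\<close>. The test bounds \<open>e\<close> by the rule of phase two only if that iteration
        belongs to phase two as well, hence \<open>Suc N\<close>.\<close>
      have e_ge: "\<theta> N * \<tau> \<le> e (x k)" if "k \<ge> Suc N" for k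
      proof -
        obtain j where j: "k = Suc j" "j \<ge> N" using \<open>k \<ge> Suc N\<close> by (auto dest: Suc_le_D)
        have "ph k = Phase_Two"
          using K2[of k] that by (simp add: N_def K2_def lco_iterations_def)
        moreover have "j \<in> K2" using K2[of j] j(2) unfolding N_def by linarith
        ultimately have "\<theta> j * E (x k) \<le> e (x k)"
          using two(2)[of j] unfolding j(1) by (metis linorder_not_less phase.distinct(1))
        then have "\<theta> N * E (x k) \<le> e (x k)" using \<theta>_const[OF j(2)] by metis
        moreover have "\<theta> N * \<tau> \<le> \<theta> N * E (x k)"
        proof (rule mult_left_mono)
          show "\<tau> \<le> E (x k)" using \<tau>[of k] that unfolding N_def by linarith
          show "0 \<le> \<theta> N" using \<theta>_pos[of N] unfolding N_def by linarith
        qed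
        ultimately show ?thesis by simp
      qed

      have "active_set A b (x k) \<subseteq> active_set A b (x (Suc k))" if "k \<ge> N" for k
        using F2 K2[of k] that by (simp add: lco_F2_def N_def)
      then obtain M where "M \<ge> N"
        and "\<And>k. k \<ge> M \<Longrightarrow> active_set A b (x (Suc k)) = active_set A b (x k)"
        using increasing_finite_sets_stabilize[of N "\<lambda>k. active_set A b (x k)"] by blast
      then have "\<forall>j\<ge>M. j \<in> K2 \<and> active_set A b (x (Suc j)) = active_set A b (x j)"
        using K2 by (auto simp: N_def)
      then have "liminf (\<lambda>j. ereal (e (x j))) = 0"
        using F3 unfolding lco_F3_def e_def by blast
      moreover have "ereal (\<theta> N * \<tau>) \<le> liminf (\<lambda>j. ereal (e (x j)))"
        by (rule Liminf_bounded) (use e_ge in \<open>auto simp: eventually_sequentially\<close>)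
      moreover have "\<theta> N * \<tau> > 0" using \<theta>_pos[of N] \<open>\<tau> > 0\<close> by (simp add: N_def)
      ultimately show False by simp
    qed
    then show ?thesis using exec by blast
  qed
qed

end
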